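(* Let $X$ be a $\sigma$-Dedekind complete Banach lattice, let $T$ be an operator on $X$, and let $\varepsilon\ge 0$. (1) If $\|[P,T]\|\le\varepsilon$ for every band projection $P$ on $X$, then $T$ is $\varepsilon$-band preserving. (2) If $T$ is $\varepsilon$-band preserving, then $\|[P,T]\|\le 2\varepsilon$ for every band projection $P$ on $X$.
   Context: $[P,T]=PT-TP$ denotes the commutator. A band in a Banach lattice $X$ is an (order) ideal $Y\subset X$ which contains $\bigvee_\alpha y_\alpha$ for every family $(y_\alpha)$ in $Y$ whose supremum exists in $X$. A band $Y$ is a projection band if $X=Y\oplus Y^\perp$, where $Y^\perp=\{x:|x|\wedge|y|=0\ \forall y\in Y\}$; the band projection onto $Y$ is the corresponding projection with range $Y$ and kernel $Y^\perp$. A linear map $T:X\to X$ is $\varepsilon$-band preserving ($\varepsilon$-BP) if for every $x\in X$, $\sup\{\||Tx|\wedge y\| : y\ge 0,\ y\perp x\}\le\varepsilon\|x\|$. $X$ is $\sigma$-Dedekind complete if every order bounded sequence has a supremum and an infimum. *)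

theory Defs
  imports
    "HOL-Analysis.Analysis"
    "HOL-Library.Lattice_Algebras"
    "HOL-Library.Lub_Glb"
begin

class banach_lattice = banach + ordered_real_vector + lattice_ab_group_add_abs +
  assumes norm_lattice_mono: "\<bar>x\<bar> \<le> \<bar>y\<bar> \<Longrightarrow> norm x \<le> norm y"

instance real :: banach_lattice
  by standard auto

definition sigma_dedekind_complete :: "'a::order itself \<Rightarrow> bool" where
  "sigma_dedekind_complete _ \<longleftrightarrow>
     (\<forall>u :: nat \<Rightarrow> 'a. bdd_above (range u) \<and> bdd_below (range u) \<longrightarrow>
        (\<exists>s. isLub UNIV (range u) s) \<and> (\<exists>i. isGlb UNIV (range u) i))"

definition lattice_disjoint :: "'a::banach_lattice \<Rightarrow> 'a \<Rightarrow> bool" where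
  "lattice_disjoint x y \<longleftrightarrow> inf \<bar>x\<bar> \<bar>y\<bar> = 0"

definition disjoint_complement :: "'a::banach_lattice set \<Rightarrow> 'a set" where
  "disjoint_complement Y = {x. \<forall>y\<in>Y. lattice_disjoint x y}"

definition order_ideal :: "'a::banach_lattice set \<Rightarrow> bool" where
  "order_ideal Y \<longleftrightarrow> subspace Y \<and> (\<forall>x. \<forall>y\<in>Y. \<bar>x\<bar> \<le> \<bar>y\<bar> \<longrightarrow> x \<in> Y)"

definition band :: "'a::banach_lattice set \<Rightarrow> bool" where
  "band Y \<longleftrightarrow> order_ideal Y \<and> (\<forall>A s. A \<subseteq> Y \<and> isLub UNIV A s \<longrightarrow> s \<in> Y)"

definition projection_band :: "'a::banach_lattice set \<Rightarrow> bool" where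
  "projection_band Y \<longleftrightarrow> band Y \<and>
     Y \<inter> disjoint_complement Y = {0} \<and>
     {y + z | y z. y \<in> Y \<and> z \<in> disjoint_complement Y} = UNIV"

definition band_projection_onto :: "'a::banach_lattice set \<Rightarrow> ('a \<Rightarrow> 'a) \<Rightarrow> bool" where
  "band_projection_onto Y P \<longleftrightarrow> projection_band Y \<and>
     linear P \<and> P \<circ> P = P \<and> range P = Y \<and> {x. P x = 0} = disjoint_complement Y"

definition band_projection :: "('a::banach_lattice \<Rightarrow> 'a) \<Rightarrow> bool" where
  "band_projection P \<longleftrightarrow> (\<exists>Y. band_projection_onto Y P)"

definition commutator :: "('a::banach_lattice \<Rightarrow> 'a) \<Rightarrow> ('a \<Rightarrow> 'a) \<Rightarrow> 'a \<Rightarrow> 'a" where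
  "commutator P T = (\<lambda>x. P (T x) - T (P x))"

text \<open>The supremum below ranges over a nonempty set (take \<open>y = 0\<close>) that is bounded above by
  \<open>norm (T x)\<close>, so the real-valued \<open>SUP\<close> is the genuine supremum.\<close>

definition eps_band_preserving :: "real \<Rightarrow> ('a::banach_lattice \<Rightarrow> 'a) \<Rightarrow> bool" where
  "eps_band_preserving \<epsilon> T \<longleftrightarrow> linear T \<and>
     (\<forall>x. (SUP y \<in> {y. 0 \<le> y \<and> lattice_disjoint y x}. norm (inf \<bar>T x\<bar> y)) \<le> \<epsilon> * norm x)"

end

theory Submission
  imports Defs
begin

text \<open>
  If $y \ge 0$, then $\sigma$-Dedekind completeness makes the band $y^{\perp\perp}$ a projection
  band: the component of $z \ge 0$ in it is $\sup_n (z \wedge n y)$. For its band projection $P$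
  and $x \perp y$ we get $Px = 0$, and hence $|Tx| \wedge y \le |PTx| = |[P,T]x|$, which gives (1).
  For (2), write $Q = I - P$. Then $[P,T] = PTQ - QTP$, and each summand is controlled by testing
  the $\varepsilon$-band preserving condition with $y = |PTQx| \perp Qx$ and $y = |QTPx| \perp Px$.
\<close>

section \<open>Order estimates in lattice-ordered groups and vector lattices\<close>

text \<open>Expanding the right-hand side by distributivity gives the meet of \<open>a + b\<close>,
  \<open>a + c\<close>, \<open>c + b\<close> and \<open>c + c\<close>. By positivity the left-hand
  side lies below each of them.\<close>

lemma inf_add_le_add_inf:
  fixes a b c :: "'a::lattice_ab_group_add"
  assumes "0 \<le> a" "0 \<le> b" "0 \<le> c"
  shows "inf (a + b) c \<le> inf a c + inf b c"
proof -
  have "inf (a + b) c \<le> a + c" "inf (a + b) c \<le> c + b" "inf (a + b) c \<le> c + c"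
    using assms by (auto intro: le_infI2 simp: add_increasing add_increasing2)
  then show ?thesis
    by (simp add: add_inf_distrib_left add_inf_distrib_right)
qed

lemma abs_scaleR_le:
  fixes x :: "'a::banach_lattice"
  shows "\<bar>c *\<^sub>R x\<bar> \<le> \<bar>c\<bar> *\<^sub>R \<bar>x\<bar>"
proof (rule abs_leI)
  have "\<bar>c\<bar> *\<^sub>R x \<le> \<bar>c\<bar> *\<^sub>R \<bar>x\<bar>" "\<bar>c\<bar> *\<^sub>R (- x) \<le> \<bar>c\<bar> *\<^sub>R \<bar>x\<bar>"
    by (auto intro!: scaleR_left_mono abs_ge_self abs_ge_minus_self simp del: scaleR_minus_right)
  then show "c *\<^sub>R x \<le> \<bar>c\<bar> *\<^sub>R \<bar>x\<bar>" "- (c *\<^sub>R x) \<le> \<bar>c\<bar> *\<^sub>R \<bar>x\<bar>"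
    by (cases "0 \<le> c"; simp)+
qed

section \<open>Calculus of disjoint elements\<close>

lemma lattice_disjoint_commute: "lattice_disjoint x y \<longleftrightarrow> lattice_disjoint y x"
  by (simp add: lattice_disjoint_def inf.commute)

lemma lattice_disjoint_zero [simp]: "lattice_disjoint 0 x"
  by (simp add: lattice_disjoint_def inf.absorb1)

lemma lattice_disjoint_self_iff: "lattice_disjoint x x \<longleftrightarrow> x = 0"
  by (simp add: lattice_disjoint_def)

lemma lattice_disjoint_mono:
  assumes "lattice_disjoint y z" "\<bar>x\<bar> \<le> \<bar>y\<bar>"
  shows "lattice_disjoint x z"
proof -
  have "inf \<bar>x\<bar> \<bar>z\<bar> \<le> inf \<bar>y\<bar> \<bar>z\<bar>"
    using assms(2) by (rule inf_mono) simp
  then show ?thesis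
    using assms(1) unfolding lattice_disjoint_def
    by (metis abs_ge_zero antisym le_inf_iff)
qed

lemma lattice_disjoint_add:
  assumes "lattice_disjoint x z" "lattice_disjoint y z"
  shows "lattice_disjoint (x + y) z"
proof -
  have "inf \<bar>x + y\<bar> \<bar>z\<bar> \<le> inf (\<bar>x\<bar> + \<bar>y\<bar>) \<bar>z\<bar>"
    by (rule inf_mono) (auto intro: abs_triangle_ineq)
  also have "\<dots> \<le> inf \<bar>x\<bar> \<bar>z\<bar> + inf \<bar>y\<bar> \<bar>z\<bar>"
    by (rule inf_add_le_add_inf) auto
  finally show ?thesis
    using assms by (auto simp: lattice_disjoint_def intro: antisym)
qed

text \<open>Natural multiples are iterated sums, so they inherit disjointness; by the Archimedean
  property, one of them dominates \<open>c *\<^sub>R x\<close> in modulus.\<close>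

lemma lattice_disjoint_scaleR:
  assumes "lattice_disjoint x z"
  shows "lattice_disjoint (c *\<^sub>R x) z"
proof -
  have multiple: "lattice_disjoint (real n *\<^sub>R \<bar>x\<bar>) z" for n
  proof (induction n)
    case (Suc n)
    have "lattice_disjoint \<bar>x\<bar> z"
      using assms by (rule lattice_disjoint_mono) simp
    then show ?case
      using lattice_disjoint_add Suc.IH by (auto simp: scaleR_left_distrib)
  qed simp
  obtain n where n: "\<bar>c\<bar> \<le> real n"
    using real_arch_simple by blast
  have "\<bar>c *\<^sub>R x\<bar> \<le> \<bar>c\<bar> *\<^sub>R \<bar>x\<bar>"
    by (rule abs_scaleR_le)
  also have "\<dots> \<le> real n *\<^sub>R \<bar>x\<bar>"
    using n by (rule scaleR_right_mono) simp
  also have "\<dots> \<le> \<bar>real n *\<^sub>R \<bar>x\<bar>\<bar>"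
    by (rule abs_ge_self)
  finally show ?thesis
    using multiple lattice_disjoint_mono by blast
qed

text \<open>Meeting \<open>\<bar>a\<bar> \<le> \<bar>a + b\<bar> + \<bar>b\<bar>\<close> with
  \<open>\<bar>a\<bar>\<close> kills the contribution of \<open>b\<close>. This later shows that
  band projections do not increase the modulus.\<close>

lemma abs_le_abs_add_disjoint:
  assumes "lattice_disjoint a b"
  shows "\<bar>a\<bar> \<le> \<bar>a + b\<bar>"
proof -
  have "\<bar>a\<bar> \<le> \<bar>a + b\<bar> + \<bar>b\<bar>"
    using abs_triangle_ineq4[of "a + b" b] by simp
  then have "\<bar>a\<bar> \<le> inf (\<bar>a + b\<bar> + \<bar>b\<bar>) \<bar>a\<bar>"
    by simp
  also have "\<dots> \<le> inf \<bar>a + b\<bar> \<bar>a\<bar> + inf \<bar>b\<bar> \<bar>a\<bar>"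
    by (rule inf_add_le_add_inf) auto
  also have "\<dots> = inf \<bar>a + b\<bar> \<bar>a\<bar>"
    using assms by (simp add: lattice_disjoint_def inf.commute)
  finally show ?thesis
    by simp
qed

section \<open>Disjoint complements are bands\<close>

lemma subspace_disjoint_complement: "subspace (disjoint_complement S)"
  by (auto simp: subspace_def disjoint_complement_def
      intro: lattice_disjoint_add lattice_disjoint_scaleR)

lemma order_ideal_disjoint_complement: "order_ideal (disjoint_complement S)"
  unfolding order_ideal_def
  by (auto simp: subspace_disjoint_complement)
    (auto simp: disjoint_complement_def intro: lattice_disjoint_mono)

lemma disjoint_complement_twice: "S \<subseteq> disjoint_complement (disjoint_complement S)"
  by (auto simp: disjoint_complement_def lattice_disjoint_commute)

text \<open>In \<open>band\<close> the family \<open>A\<close> may be empty, and its supremum would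
  be a least element. Comparing such an \<open>s\<close> with \<open>s + s\<close> and with
  \<open>0\<close> forces \<open>s = 0\<close>.\<close>

lemma isLub_empty_eq_zero:
  fixes s :: "'a::ordered_ab_group_add"
  assumes "isLub UNIV {} s"
  shows "s = 0"
proof -
  have least: "s \<le> x" for x
    using assms by (auto simp: isLub_def leastP_def isUb_def setle_def setge_def)
  have "s \<le> s + s"
    by (rule least)
  then have "0 \<le> s"
    by simp
  then show ?thesis
    using least[of 0] by (rule antisym[rotated])
qed

text \<open>Elements of \<open>A\<close> may have any sign, so the supremum is first translated by
  some \<open>a0\<close> in \<open>A\<close>, which makes it nonnegative. If \<open>w\<close> is the
  overlap of \<open>s - a0\<close> with \<open>\<bar>y\<bar>\<close>, then \<open>s - w\<close> is
  still an upper bound of \<open>A\<close>, and leastness of \<open>s\<close> gives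
  \<open>w = 0\<close>.\<close>

lemma disjoint_complement_closed_isLub:
  assumes sub: "A \<subseteq> disjoint_complement S" and lub: "isLub UNIV A s"
  shows "s \<in> disjoint_complement S"
proof (cases "A = {}")
  case True
  then show ?thesis
    using isLub_empty_eq_zero[of s] lub by (simp add: disjoint_complement_def)
next
  case False
  then obtain a0 where a0: "a0 \<in> A" by blast
  have upper: "a \<le> s" if "a \<in> A" for a
    using lub that by (rule isLubD2)
  define r where "r = s - a0"
  have r0: "0 \<le> r"
    using upper[OF a0] by (simp add: r_def)
  have "lattice_disjoint r y" if y: "y \<in> S" for y
  proof -
    define w where "w = inf r \<bar>y\<bar>"
    have w: "0 \<le> w" "w \<le> r" "w \<le> \<bar>y\<bar>"
      using r0 by (auto simp: w_def)
    \<comment> \<open>Both \<open>(a - a0)\<^sup>+\<close> and \<open>w\<close> lie below \<open>r\<close>, and they are disjoint, so their sum does too.\<close>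
    have "a \<le> s - w" if a: "a \<in> A" for a
    proof -
      define p where "p = sup (a - a0) 0"
      have p: "0 \<le> p" "p \<le> r" "a - a0 \<le> p" "p \<le> \<bar>a - a0\<bar>"
        using upper[OF a] r0 by (auto simp: p_def r_def abs_ge_self)
      have "a - a0 \<in> disjoint_complement S"
        using sub a a0 subspace_diff[OF subspace_disjoint_complement] by blast
      then have "inf \<bar>a - a0\<bar> \<bar>y\<bar> = 0"
        using y by (auto simp: disjoint_complement_def lattice_disjoint_def)
      moreover have "inf p w \<le> inf \<bar>a - a0\<bar> \<bar>y\<bar>"
        using p w by (intro inf_mono)
      moreover have "0 \<le> inf p w"
        using p w by simp
      ultimately have "inf p w = 0"
        by (simp add: antisym)
      then have "p + w = sup p w"
        using add_eq_inf_sup[of p w] by simp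
      also have "\<dots> \<le> r"
        using p w by simp
      finally have "p + w \<le> r" .
      then have "(a - a0) + w \<le> r"
        using p(3) by (meson add_right_mono order_trans)
      then show ?thesis
        by (simp add: r_def algebra_simps)
    qed
    then have "isUb UNIV A (s - w)"
      by (auto simp: isUb_def setle_def)
    then have "s \<le> s - w"
      using lub isLub_le_isUb by blast
    then have "w = 0"
      using w(1) by (simp add: antisym)
    then show ?thesis
      using r0 by (simp add: w_def lattice_disjoint_def)
  qed
  then have "r \<in> disjoint_complement S"
    by (simp add: disjoint_complement_def)
  then have "r + a0 \<in> disjoint_complement S"
    using a0 sub subspace_add[OF subspace_disjoint_complement] by blast
  then show ?thesis
    by (simp add: r_def)
qed

lemma band_disjoint_complement: "band (disjoint_complement S)"
  using order_ideal_disjoint_complement disjoint_complement_closed_isLub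
  unfolding band_def by blast

section \<open>Existence of projections onto principal bands\<close>

text \<open>A band meets its disjoint complement only in \<open>0\<close>, so the components in
  \<open>split\<close> are unique. Uniqueness makes the chosen map \<open>P\<close> linear,
  idempotent and zero on the complement.\<close>

lemma ex_band_projection_onto:
  fixes Y :: "'a::banach_lattice set"
  assumes "band Y" and split: "\<And>x. \<exists>y\<in>Y. x - y \<in> disjoint_complement Y"
  shows "\<exists>P. band_projection_onto Y P"
proof -
  let ?Z = "disjoint_complement Y"
  have Y: "subspace Y"
    using assms(1) by (simp add: band_def order_ideal_def)
  have Z: "subspace ?Z"
    by (rule subspace_disjoint_complement)
  have trivial: "v = 0" if "v \<in> Y" "v \<in> ?Z" for v
    using that by (auto simp: disjoint_complement_def lattice_disjoint_self_iff)
  obtain P where P: "\<And>x. P x \<in> Y" "\<And>x. x - P x \<in> ?Z"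
    using split by metis
  have unique: "P x = y" if "y \<in> Y" "x - y \<in> ?Z" for x y
  proof -
    \<comment> \<open>This vector equals \<open>P x - y\<close>, which therefore lies in both
      \<open>Y\<close> and \<open>?Z\<close>.\<close>
    have "(x - y) - (x - P x) \<in> ?Z"
      using that P subspace_diff[OF Z] by blast
    moreover have "P x - y \<in> Y"
      using that P subspace_diff[OF Y] by blast
    ultimately show ?thesis
      using trivial[of "P x - y"] by simp
  qed
  have "linear P"
  proof (rule linearI)
    fix x y
    have "(x - P x) + (y - P y) \<in> ?Z"
      using P subspace_add[OF Z] by blast
    then show "P (x + y) = P x + P y"
      using P subspace_add[OF Y] by (intro unique) (auto simp: algebra_simps)
  next
    fix c x
    have "c *\<^sub>R (x - P x) \<in> ?Z"
      using P subspace_scale[OF Z] by blast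
    then show "P (c *\<^sub>R x) = c *\<^sub>R P x"
      using P subspace_scale[OF Y] by (intro unique) (auto simp: algebra_simps)
  qed
  moreover have fixed: "P y = y" if "y \<in> Y" for y
    using that subspace_0[OF Z] by (intro unique) auto
  moreover have "P \<circ> P = P"
    using fixed P by auto
  moreover have "range P = Y"
    using fixed P by (metis image_subsetI rangeI subsetI subset_antisym)
  moreover have "{x. P x = 0} = ?Z"
  proof (intro subset_antisym subsetI)
    fix x assume "x \<in> {x. P x = 0}"
    then show "x \<in> ?Z"
      using P(2)[of x] by simp
  next
    fix x assume "x \<in> ?Z"
    then show "x \<in> {x. P x = 0}"
      using unique[of 0 x] subspace_0[OF Y] by simp
  qed
  moreover have "projection_band Y"
    unfolding projection_band_def
  proof (intro conjI)
    show "Y \<inter> ?Z = {0}"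
      using trivial subspace_0[OF Y] subspace_0[OF Z] by auto
    have "x = P x + (x - P x)" for x
      by simp
    then show "{y + z |y z. y \<in> Y \<and> z \<in> ?Z} = UNIV"
      using P by blast
  qed (rule assms(1))
  ultimately show ?thesis
    by (auto simp: band_projection_onto_def)
qed

lemma principal_band_split_nonneg:
  fixes y z :: "'a::banach_lattice"
  assumes sdc: "sigma_dedekind_complete TYPE('a)" and y: "0 \<le> y" and z: "0 \<le> z"
  shows "\<exists>s\<in>disjoint_complement (disjoint_complement {y}). z - s \<in> disjoint_complement {y}"
proof -
  let ?Y = "disjoint_complement (disjoint_complement {y})"
  define u where "u n = inf z (real n *\<^sub>R y)" for n
  have ny: "0 \<le> real n *\<^sub>R y" for n
    using y by (simp add: scaleR_nonneg_nonneg)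
  have u: "0 \<le> u n" "u n \<le> z" "u n \<le> real n *\<^sub>R y" for n
    using z ny by (auto simp: u_def)
  have "bdd_above (range u)" "bdd_below (range u)"
    using u by (auto simp: bdd_above_def bdd_below_def)
  then obtain s where s: "isLub UNIV (range u) s"
    using sdc by (auto simp: sigma_dedekind_complete_def)
  have "u n \<in> ?Y" for n
  proof -
    have "y \<in> ?Y"
      using disjoint_complement_twice by blast
    then have "real n *\<^sub>R y \<in> ?Y"
      using subspace_scale[OF subspace_disjoint_complement] by blast
    moreover have "\<bar>u n\<bar> \<le> \<bar>real n *\<^sub>R y\<bar>"
      using u ny by (simp add: abs_of_nonneg)
    ultimately show ?thesis
      using order_ideal_disjoint_complement unfolding order_ideal_def by blast
  qed
  then have sY: "s \<in> ?Y"
    using disjoint_complement_closed_isLub s by blast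
  have "isUb UNIV (range u) z"
    using u by (auto simp: isUb_def setle_def)
  then have sz: "s \<le> z"
    using s isLub_le_isUb by blast
  \<comment> \<open>\<open>w\<close> measures the failure of \<open>z - s\<close> to be disjoint
    from \<open>y\<close>; it vanishes once \<open>s - w\<close> is shown to bound the sequence
    \<open>u\<close>.\<close>
  define w where "w = inf (z - s) y"
  have w: "0 \<le> w" "w \<le> z - s" "w \<le> y"
    using sz y by (auto simp: w_def)
  have us: "u n \<le> s" for n
    using s by (rule isLubD2) simp
  \<comment> \<open>Adding \<open>w\<close> to \<open>u n\<close> costs at most one more copy of
    \<open>y\<close> and stays below \<open>z\<close>, so the sum is absorbed by the next term of
    the sequence.\<close>
  have "u n \<le> s - w" for n
  proof -
    have "w + u n \<le> (z - s) + s"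
      using w us by (intro add_mono)
    moreover have "w + u n \<le> y + real n *\<^sub>R y"
      using w u by (intro add_mono)
    ultimately have "w + u n \<le> u (Suc n)"
      by (simp add: u_def scaleR_left_distrib)
    also have "\<dots> \<le> s"
      by (rule us)
    finally show ?thesis
      by (simp add: algebra_simps)
  qed
  then have "isUb UNIV (range u) (s - w)"
    by (auto simp: isUb_def setle_def)
  then have "s \<le> s - w"
    using s isLub_le_isUb by blast
  then have "w = 0"
    using w by (simp add: antisym)
  then have "z - s \<in> disjoint_complement {y}"
    using sz y by (simp add: w_def disjoint_complement_def lattice_disjoint_def)
  then show ?thesis
    using sY by blast
qed

lemma ex_principal_band_projection:
  fixes y :: "'a::banach_lattice"
  assumes "sigma_dedekind_complete TYPE('a)" and "0 \<le> y"
  shows "\<exists>P. band_projection_onto (disjoint_complement (disjoint_complement {y})) P"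
proof (rule ex_band_projection_onto[OF band_disjoint_complement])
  fix x :: 'a
  let ?Z = "disjoint_complement {y}"
  let ?Y = "disjoint_complement ?Z"
  \<comment> \<open>Writing \<open>x\<close> as \<open>\<bar>x\<bar> - (\<bar>x\<bar> - x)\<close>,
    a difference of nonnegative vectors, reduces the splitting to the nonnegative case.\<close>
  have "0 \<le> \<bar>x\<bar> - x"
    by (simp add: abs_ge_self)
  then obtain s t where s: "s \<in> ?Y" "\<bar>x\<bar> - s \<in> ?Z" and t: "t \<in> ?Y" "(\<bar>x\<bar> - x) - t \<in> ?Z"
    using principal_band_split_nonneg[OF assms] abs_ge_zero by metis
  have "s - t \<in> ?Y" "(\<bar>x\<bar> - s) - ((\<bar>x\<bar> - x) - t) \<in> ?Z"
    using s t subspace_diff[OF subspace_disjoint_complement] by blast+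
  moreover have "(\<bar>x\<bar> - s) - ((\<bar>x\<bar> - x) - t) = x - (s - t)"
    by simp
  \<comment> \<open>The remainder is required to lie in the triple complement of \<open>{y}\<close>,
    which contains \<open>?Z\<close>.\<close>
  ultimately show "\<exists>v\<in>?Y. x - v \<in> disjoint_complement ?Y"
    using disjoint_complement_twice by (metis subsetD)
qed

section \<open>Band projections and boundedness of commutators\<close>

text \<open>\<open>x\<close> and \<open>z\<close> are unrelated, so components of different vectors
  can be compared, such as \<open>P (T q)\<close> with \<open>q = x - P x\<close>.\<close>

lemma band_projection_onto_disjoint:
  assumes "band_projection_onto Y P"
  shows "lattice_disjoint (P x) (z - P z)"
proof -
  have "P (P z) = P z"
    using assms by (metis band_projection_onto_def comp_apply)
  then have "P (z - P z) = 0"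
    using assms by (simp add: band_projection_onto_def linear_diff)
  then have "z - P z \<in> disjoint_complement Y" "P x \<in> Y"
    using assms by (auto simp: band_projection_onto_def)
  then show ?thesis
    by (auto simp: disjoint_complement_def lattice_disjoint_commute)
qed

lemma band_projection_onto_abs_le:
  assumes "band_projection_onto Y P"
  shows "\<bar>P x\<bar> \<le> \<bar>x\<bar>" "\<bar>x - P x\<bar> \<le> \<bar>x\<bar>"
  using abs_le_abs_add_disjoint[of "P x" "x - P x"] abs_le_abs_add_disjoint[of "x - P x" "P x"]
    band_projection_onto_disjoint[OF assms, of x x] lattice_disjoint_commute[of "x - P x" "P x"]
  by simp_all

lemma band_projection_onto_bounded_linear:
  assumes "band_projection_onto Y P"
  shows "bounded_linear P"
proof -
  interpret linear P
    using assms by (simp add: band_projection_onto_def)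
  have "norm (P x) \<le> norm x * 1" for x
    using band_projection_onto_abs_le[OF assms] norm_lattice_mono by auto
  then show ?thesis
    by (intro bounded_linear_intro[where K = 1]) (auto simp: add scale)
qed

text \<open>Boundedness is what permits passing from the operator norm of the commutator to its
  value at a single vector.\<close>

lemma bounded_linear_commutator:
  assumes "bounded_linear P" "bounded_linear T"
  shows "bounded_linear (commutator P T)"
  unfolding commutator_def
  using bounded_linear_sub[OF bounded_linear_compose[OF assms]
      bounded_linear_compose[OF assms(2,1)]] .

section \<open>Band preserving estimates and the two implications\<close>

text \<open>The real \<open>SUP\<close> dominates its members only when they are bounded above; here
  \<open>norm (T x)\<close> is a bound.\<close>

lemma eps_band_preservingD:
  assumes "eps_band_preserving \<epsilon> T" "0 \<le> y" "lattice_disjoint y x"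
  shows "norm (inf \<bar>T x\<bar> y) \<le> \<epsilon> * norm x"
proof -
  have "norm (inf \<bar>T x\<bar> v) \<le> norm (T x)" if "0 \<le> v" for v
    using that by (intro norm_lattice_mono) (simp add: abs_of_nonneg)
  then have "bdd_above ((\<lambda>v. norm (inf \<bar>T x\<bar> v)) ` {v. 0 \<le> v \<and> lattice_disjoint v x})"
    by (intro bdd_aboveI2[where M = "norm (T x)"]) auto
  then have "norm (inf \<bar>T x\<bar> y) \<le> (SUP v \<in> {v. 0 \<le> v \<and> lattice_disjoint v x}. norm (inf \<bar>T x\<bar> v))"
    using assms by (intro cSUP_upper) auto
  then show ?thesis
    using assms(1) unfolding eps_band_preserving_def by (meson order_trans)
qed

text \<open>Testing with \<open>y = \<bar>v\<bar>\<close> turns the meet with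
  \<open>\<bar>T x\<bar>\<close> into \<open>\<bar>v\<bar>\<close> itself, which yields a form of
  the condition for vectors of arbitrary sign.\<close>

lemma eps_band_preserving_norm_le:
  assumes "eps_band_preserving \<epsilon> T" "lattice_disjoint v x" "\<bar>v\<bar> \<le> \<bar>T x\<bar>"
  shows "norm v \<le> \<epsilon> * norm x"
proof -
  have "lattice_disjoint \<bar>v\<bar> x"
    using assms(2) by (rule lattice_disjoint_mono) simp
  then have "norm (inf \<bar>T x\<bar> \<bar>v\<bar>) \<le> \<epsilon> * norm x"
    using assms(1) by (intro eps_band_preservingD) auto
  moreover have "norm v \<le> norm \<bar>v\<bar>"
    by (rule norm_lattice_mono) simp
  ultimately show ?thesis
    using assms(3) by (simp add: inf.absorb2)
qed

lemma eps_band_preserving_if_commutators_le: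
  fixes T :: "'a::banach_lattice \<Rightarrow> 'a"
  assumes sdc: "sigma_dedekind_complete TYPE('a)" and T: "bounded_linear T"
    and comm: "\<And>P. band_projection P \<Longrightarrow> onorm (commutator P T) \<le> \<epsilon>"
  shows "eps_band_preserving \<epsilon> T"
proof -
  have "norm (inf \<bar>T x\<bar> y) \<le> \<epsilon> * norm x" if y: "0 \<le> y" "lattice_disjoint y x" for x y
  proof -
    \<comment> \<open>The band generated by \<open>y\<close> puts \<open>y\<close> in the range of
      \<open>P\<close> and \<open>x\<close> in its kernel.\<close>
    let ?Y = "disjoint_complement (disjoint_complement {y})"
    obtain P where P: "band_projection_onto ?Y P"
      using ex_principal_band_projection[OF sdc y(1)] by blast
    have "x \<in> disjoint_complement {y}"
      using y by (simp add: disjoint_complement_def lattice_disjoint_commute)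
    then have "x \<in> disjoint_complement ?Y"
      using disjoint_complement_twice by blast
    then have "P x = 0"
      using P by (auto simp: band_projection_onto_def)
    then have comm_x: "commutator P T x = P (T x)"
      using T by (simp add: commutator_def linear_0 bounded_linear.linear)
    have "y \<in> range P"
      using P disjoint_complement_twice[of "{y}"] by (auto simp: band_projection_onto_def)
    then have "lattice_disjoint y (T x - P (T x))"
      using band_projection_onto_disjoint[OF P] by blast
    then have disj: "inf \<bar>T x - P (T x)\<bar> y = 0"
      using y(1) by (simp add: lattice_disjoint_def abs_of_nonneg inf.commute)
    have "\<bar>T x\<bar> \<le> \<bar>P (T x)\<bar> + \<bar>T x - P (T x)\<bar>"
      using abs_triangle_ineq[of "P (T x)" "T x - P (T x)"] by simp
    then have "inf \<bar>T x\<bar> y \<le> inf (\<bar>P (T x)\<bar> + \<bar>T x - P (T x)\<bar>) y"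
      by (rule inf_mono) simp
    also have "\<dots> \<le> inf \<bar>P (T x)\<bar> y + inf \<bar>T x - P (T x)\<bar> y"
      using y(1) by (intro inf_add_le_add_inf) auto
    also have "\<dots> \<le> \<bar>P (T x)\<bar>"
      by (simp add: disj)
    finally have "norm (inf \<bar>T x\<bar> y) \<le> norm (commutator P T x)"
      using y(1) by (intro norm_lattice_mono) (simp add: abs_of_nonneg comm_x)
    also have "\<dots> \<le> onorm (commutator P T) * norm x"
      using bounded_linear_commutator[OF band_projection_onto_bounded_linear[OF P] T]
      by (rule onorm)
    also have "\<dots> \<le> \<epsilon> * norm x"
      using comm P by (intro mult_right_mono) (auto simp: band_projection_def)
    finally show ?thesis .
  qed
  \<comment> \<open>Bounding a real \<open>SUP\<close> from above by a bound on its members requires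
    a nonempty index set; \<open>0\<close> always belongs to it.\<close>
  moreover have "{y. 0 \<le> y \<and> lattice_disjoint y x} \<noteq> {}" for x :: 'a
    using lattice_disjoint_zero by blast
  ultimately show ?thesis
    using T by (auto simp: eps_band_preserving_def bounded_linear.linear intro!: cSUP_least)
qed

lemma onorm_commutator_le_if_eps_band_preserving:
  assumes bp: "eps_band_preserving \<epsilon> T" and "band_projection P" and "0 \<le> \<epsilon>"
  shows "onorm (commutator P T) \<le> 2 * \<epsilon>"
proof -
  obtain Y where P: "band_projection_onto Y P"
    using assms(2) by (auto simp: band_projection_def)
  have linP: "linear P" and linT: "linear T"
    using P bp by (auto simp: band_projection_onto_def eps_band_preserving_def)
  have "norm (commutator P T x) \<le> 2 * \<epsilon> * norm x" for x
  proof -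
    define p q where "p = P x" and "q = x - P x"
    \<comment> \<open>Here \<open>v = P (T q)\<close> lies in the band \<open>Y\<close>, is disjoint
      from \<open>q\<close>, and is dominated in modulus by \<open>T q\<close>.\<close>
    have "norm (P (T q)) \<le> \<epsilon> * norm q"
      using band_projection_onto_disjoint[OF P] band_projection_onto_abs_le[OF P] bp
      unfolding q_def by (intro eps_band_preserving_norm_le) auto
    also have "\<dots> \<le> \<epsilon> * norm x"
      using band_projection_onto_abs_le[OF P] \<open>0 \<le> \<epsilon>\<close>
      unfolding q_def by (intro mult_left_mono norm_lattice_mono) auto
    finally have PTQ: "norm (P (T q)) \<le> \<epsilon> * norm x" .
    \<comment> \<open>The roles of the band and its complement are exchanged: the complementary part
      of \<open>T p\<close> is disjoint from \<open>p\<close>.\<close>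
    have "norm (T p - P (T p)) \<le> \<epsilon> * norm p"
      using band_projection_onto_disjoint[OF P] band_projection_onto_abs_le[OF P] bp
      unfolding p_def
      by (intro eps_band_preserving_norm_le) (auto simp: lattice_disjoint_commute[of _ "P x"])
    also have "\<dots> \<le> \<epsilon> * norm x"
      using band_projection_onto_abs_le[OF P] \<open>0 \<le> \<epsilon>\<close>
      unfolding p_def by (intro mult_left_mono norm_lattice_mono) auto
    finally have QTP: "norm (T p - P (T p)) \<le> \<epsilon> * norm x" .
    \<comment> \<open>Substituting \<open>x = p + q\<close> in \<open>P (T x) - T p\<close> gives
      this; the triangle inequality then produces the factor 2.\<close>
    have "commutator P T x = P (T q) - (T p - P (T p))"
      using linP linT by (simp add: commutator_def p_def q_def linear_diff)
    then have "norm (commutator P T x) \<le> norm (P (T q)) + norm (T p - P (T p))"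
      by (simp add: norm_triangle_ineq4)
    then show ?thesis
      using PTQ QTP by simp
  qed
  then show ?thesis
    using \<open>0 \<le> \<epsilon>\<close> by (intro onorm_bound) auto
qed

theorem proposition2p4:
  fixes T :: "'a::banach_lattice \<Rightarrow> 'a" and \<epsilon> :: real
  assumes "sigma_dedekind_complete TYPE('a)"
    and "bounded_linear T"
    and "0 \<le> \<epsilon>"
  shows "((\<forall>P. band_projection P \<longrightarrow> onorm (commutator P T) \<le> \<epsilon>) \<longrightarrow>
            eps_band_preserving \<epsilon> T) \<and>
         (eps_band_preserving \<epsilon> T \<longrightarrow>
            (\<forall>P. band_projection P \<longrightarrow> onorm (commutator P T) \<le> 2 * \<epsilon>))"
  using eps_band_preserving_if_commutators_le[OF assms(1,2)]
    onorm_commutator_le_if_eps_band_preserving assms(3)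
  by blast

end
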